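(* Let $d\ge 1$ be an integer. For every $a>0$, the function $|\cdot|_a$ defines a norm on $\mathbb{R}^d$. For every $x\in\mathbb{R}^d$, $|x|_a$ is monotone increasing in $a\in(0,\infty)$ and obeys $$ \lim_{a\to 0}|x|_a = \|x\|_2, \qquad \lim_{a\to\infty}|x|_a = \|x\|_1; $$ in fact, as $a\to 0$, $|x|_a = \|x\|_2(1+O(a^2))$ uniformly in $x\neq 0$. In particular, for all $a>0$ and $x\in\mathbb{R}^d$, $$ \|x\|_2\le |x|_a\le\|x\|_1 . $$
   Context: For $a\ge0$, $m_a\ge 0$ is the unique nonnegative solution of $\cosh m_a = 1+da^2$. For nonzero $x\in\mathbb{R}^d$ and $a \ge 0$, $u_a(x)\ge 0$ is the unique solution $u \ge 0$ of $\frac1d\sum_{i=1}^d \sqrt{1+x_i^2u^2} = 1+a^2$ (the left-hand side is strictly increasing in $u\in[0,\infty)$ onto $[1,\infty)$). For $a>0$, set $|0|_a=0$ and for nonzero $x\in\mathbb{R}^d$, $$ |x|_a = \frac{1}{m_a}\sum_{i=1}^d x_i\,\mathrm{arcsinh}(x_i u_a(x)). $$ "Monotone increasing" is in the weak sense (nondecreasing). $\|\cdot\|_1,\|\cdot\|_2$ are the usual $\ell^1$ and Euclidean norms. *)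

theory Defs
  imports "HOL-Analysis.Analysis"
begin

text \<open>
  The norm \<open>|x|\<^sub>a\<close> on \<open>\<real>\<^sup>d\<close>, with \<open>\<real>\<^sup>d\<close> rendered as \<^typ>\<open>real ^ 'n\<close> and
  \<open>d = CARD('n) \<ge> 1\<close>.
\<close>

definition mass :: "nat \<Rightarrow> real \<Rightarrow> real" where
  "mass d a = (THE m. m \<ge> 0 \<and> cosh m = 1 + real d * a\<^sup>2)"

definition u_sol :: "real \<Rightarrow> real ^ 'n \<Rightarrow> real" where
  "u_sol a x = (THE u. u \<ge> 0 \<and>
     (1 / real CARD('n)) * (\<Sum>i\<in>UNIV. sqrt (1 + (x $ i)\<^sup>2 * u\<^sup>2)) = 1 + a\<^sup>2)"

definition a_norm :: "real \<Rightarrow> real ^ 'n \<Rightarrow> real" where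
  "a_norm a x = (if x = 0 then 0
     else (1 / mass CARD('n) a) * (\<Sum>i\<in>UNIV. x $ i * arsinh (x $ i * u_sol a x)))"

definition l1_norm :: "real ^ 'n \<Rightarrow> real" where
  "l1_norm x = (\<Sum>i\<in>UNIV. \<bar>x $ i\<bar>)"

definition is_norm :: "('v::real_vector \<Rightarrow> real) \<Rightarrow> bool" where
  "is_norm N \<longleftrightarrow>
     (\<forall>x. N x \<ge> 0) \<and>
     (\<forall>x. N x = 0 \<longleftrightarrow> x = 0) \<and>
     (\<forall>c x. N (c *\<^sub>R x) = \<bar>c\<bar> * N x) \<and>
     (\<forall>x y. N (x + y) \<le> N x + N y)"

text \<open>The descriptions defining \<^const>\<open>mass\<close> and \<^const>\<open>u_sol\<close> denote.\<close>

lemma mass_ex1: "\<exists>!m. m \<ge> 0 \<and> cosh m = 1 + real d * a\<^sup>2"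
proof (rule ex_ex1I)
  have "cosh (arcosh (1 + real d * a\<^sup>2)) = 1 + real d * a\<^sup>2"
    by (rule cosh_arcosh_real) simp
  moreover have "arcosh (1 + real d * a\<^sup>2) \<ge> 0"
    by (simp add: arcosh_real_def add_increasing2)
  ultimately show "\<exists>m. m \<ge> 0 \<and> cosh m = 1 + real d * a\<^sup>2" by blast
next
  fix m m' :: real
  assume "m \<ge> 0 \<and> cosh m = 1 + real d * a\<^sup>2" "m' \<ge> 0 \<and> cosh m' = 1 + real d * a\<^sup>2"
  then show "m = m'" by (metis arcosh_cosh_real)
qed

lemma u_sol_ex1:
  fixes x :: "real ^ 'n"
  assumes "x \<noteq> 0"
  shows "\<exists>!u. u \<ge> 0 \<and>
    (1 / real CARD('n)) * (\<Sum>i\<in>UNIV. sqrt (1 + (x $ i)\<^sup>2 * u\<^sup>2)) = 1 + a\<^sup>2"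
proof -
  define f where "f u = (1 / real CARD('n)) * (\<Sum>i\<in>UNIV. sqrt (1 + (x $ i)\<^sup>2 * u\<^sup>2))" for u
  obtain k where k: "x $ k \<noteq> 0" using assms by (auto simp: vec_eq_iff)
  have strict: "f u < f v" if "0 \<le> u" "u < v" for u v
  proof -
    have uv: "u\<^sup>2 < v\<^sup>2" using that by (simp add: power_strict_mono)
    have "(\<Sum>i\<in>UNIV. sqrt (1 + (x $ i)\<^sup>2 * u\<^sup>2)) < (\<Sum>i\<in>UNIV. sqrt (1 + (x $ i)\<^sup>2 * v\<^sup>2))"
    proof (rule sum_strict_mono_ex1)
      show "\<forall>i\<in>UNIV. sqrt (1 + (x $ i)\<^sup>2 * u\<^sup>2) \<le> sqrt (1 + (x $ i)\<^sup>2 * v\<^sup>2)"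
        using uv by (auto intro!: mult_left_mono)
      show "\<exists>i\<in>UNIV. sqrt (1 + (x $ i)\<^sup>2 * u\<^sup>2) < sqrt (1 + (x $ i)\<^sup>2 * v\<^sup>2)"
        using uv k by (intro bexI[of _ k]) auto
    qed simp
    then show ?thesis unfolding f_def by (intro mult_strict_left_mono) auto
  qed
  define b where "b = real CARD('n) * (1 + a\<^sup>2) / \<bar>x $ k\<bar>"
  have b0: "b \<ge> 0" by (simp add: b_def)
  have "real CARD('n) * (1 + a\<^sup>2) = \<bar>x $ k\<bar> * b" using k by (simp add: b_def)
  also have "\<dots> = sqrt ((x $ k)\<^sup>2 * b\<^sup>2)" using b0 by (simp add: real_sqrt_mult)
  also have "\<dots> \<le> sqrt (1 + (x $ k)\<^sup>2 * b\<^sup>2)" by simp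
  also have "\<dots> \<le> (\<Sum>i\<in>UNIV. sqrt (1 + (x $ i)\<^sup>2 * b\<^sup>2))"
    by (rule member_le_sum) auto
  finally have fb: "1 + a\<^sup>2 \<le> f b" by (simp add: f_def field_simps)
  have f0: "f 0 \<le> 1 + a\<^sup>2" by (simp add: f_def)
  have "continuous_on {0..b} f" unfolding f_def by (intro continuous_intros)
  then obtain u where "0 \<le> u" "f u = 1 + a\<^sup>2" using IVT'[of f 0 "1 + a\<^sup>2" b] f0 fb b0 by auto
  moreover have "v = w" if "v \<ge> 0 \<and> f v = 1 + a\<^sup>2" "w \<ge> 0 \<and> f w = 1 + a\<^sup>2" for v w
    using strict[of v w] strict[of w v] that by (cases v w rule: linorder_cases) auto
  ultimately have "\<exists>!u. u \<ge> 0 \<and> f u = 1 + a\<^sup>2" by blast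
  then show ?thesis unfolding f_def .
qed

end

theory Submission
  imports Defs "HOL-Real_Asymp.Real_Asymp"
begin

text \<open>
  By Lagrange multipliers, \<open>m\<^sub>a |x|\<^sub>a\<close> is the maximum of \<open>x \<bullet> \<lambda>\<close> over the symmetric convex body
  \<open>\<Sum>\<^sub>i (cosh \<lambda>\<^sub>i - 1) \<le> cosh m\<^sub>a - 1\<close>, attained at \<open>\<lambda>\<^sub>i = arsinh (x\<^sub>i u\<^sub>a(x))\<close>; so \<open>|\<sqdot>|\<^sub>a\<close> is a
  support function, hence a norm. The bounds and limits come from comparing this body with the
  Euclidean ball and the cube. Monotonicity holds because the bodies rescaled by \<open>1 / m\<^sub>a\<close> increase
  with \<open>a\<close>, i.e. \<open>(cosh (t m) - 1) / (cosh m - 1)\<close> decreases in \<open>m\<close> for \<open>0 \<le> t \<le> 1\<close>.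
\<close>

section \<open>Inequalities for hyperbolic functions\<close>

lemma cosh_diff_one: "cosh x - 1 = 2 * (sinh (x / 2))\<^sup>2" for x :: real
  using cosh_double_cosh[of "x / 2"] by (simp add: cosh_square_eq)

text \<open>Convexity of \<open>cosh\<close>, from \<open>1 + t \<le> exp t\<close> applied to both
  exponentials. It certifies the Lagrange point as a global maximiser.\<close>

lemma cosh_above_tangent: "cosh z + sinh z * (y - z) \<le> cosh y" for y z :: real
proof -
  have "exp z * (1 + (y - z)) \<le> exp z * exp (y - z)"
    by (intro mult_left_mono exp_ge_add_one_self) auto
  moreover have "exp (- z) * (1 + (z - y)) \<le> exp (- z) * exp (z - y)"
    by (intro mult_left_mono exp_ge_add_one_self) auto
  ultimately show ?thesis
    by (simp add: cosh_field_def sinh_field_def field_simps flip: exp_add)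
qed

lemma sinh_ge_self:
  fixes x :: real
  assumes "0 \<le> x"
  shows "x \<le> sinh x"
proof -
  have "sinh 0 - 0 \<le> sinh x - x"
    by (rule DERIV_nonneg_imp_nondecreasing[OF assms])
       (auto intro!: derivative_eq_intros cosh_real_ge_1)
  then show ?thesis by simp
qed

lemma sinh_le_mult_cosh:
  fixes x :: real
  assumes "0 \<le> x"
  shows "sinh x \<le> x * cosh x"
proof -
  have "0 * cosh 0 - sinh 0 \<le> x * cosh x - sinh x"
    by (rule DERIV_nonneg_imp_nondecreasing[OF assms])
       (auto intro!: derivative_eq_intros)
  then show ?thesis by simp
qed

text \<open>\<open>sinh\<close> is convex on the nonnegative axis and vanishes at 0.\<close>

lemma sinh_mult_le:
  fixes t x :: real
  assumes "0 \<le> x" "0 \<le> t" "t \<le> 1"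
  shows "sinh (t * x) \<le> t * sinh x"
proof -
  have "t * sinh 0 - sinh (t * 0) \<le> t * sinh x - sinh (t * x)"
  proof (rule DERIV_nonneg_imp_nondecreasing[OF assms(1)])
    fix y :: real assume "0 \<le> y"
    then have "t * y \<le> y" using assms by (simp add: mult_left_le_one_le)
    then have "cosh (t * y) \<le> cosh y" using \<open>0 \<le> y\<close> assms by (simp add: cosh_real_nonneg_le_iff)
    then have "0 \<le> t * (cosh y - cosh (t * y))" using assms by simp
    moreover have "((\<lambda>y. t * sinh y - sinh (t * y)) has_real_derivative
        t * (cosh y - cosh (t * y))) (at y)"
      by (auto intro!: derivative_eq_intros simp: algebra_simps)
    ultimately show "\<exists>D. ((\<lambda>y. t * sinh y - sinh (t * y)) has_real_derivative D) (at y) \<and> 0 \<le> D"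
      by blast
  qed
  then show ?thesis by simp
qed

text \<open>This fixes the sign of the derivative of \<open>sinh (t * y) / sinh y\<close>. The
  difference of the two sides vanishes at 0 and its derivative collapses to
  \<open>(1 - t^2) * sinh (t * y) * sinh y\<close>.\<close>

lemma mult_cosh_mult_sinh_le:
  fixes t x :: real
  assumes "0 \<le> x" "0 \<le> t" "t \<le> 1"
  shows "t * cosh (t * x) * sinh x \<le> sinh (t * x) * cosh x"
proof -
  have "sinh (t * 0) * cosh 0 - t * cosh (t * 0) * sinh 0
      \<le> sinh (t * x) * cosh x - t * cosh (t * x) * sinh x"
  proof (rule DERIV_nonneg_imp_nondecreasing[OF assms(1)])
    fix y :: real assume "0 \<le> y"
    then have "0 \<le> (1 - t\<^sup>2) * (sinh (t * y) * sinh y)"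
      using assms by (intro mult_nonneg_nonneg) (auto simp: power_le_one)
    moreover have "((\<lambda>y. sinh (t * y) * cosh y - t * cosh (t * y) * sinh y) has_real_derivative
        (1 - t\<^sup>2) * (sinh (t * y) * sinh y)) (at y)"
      by (auto intro!: derivative_eq_intros simp: algebra_simps power2_eq_square)
    ultimately show "\<exists>D. ((\<lambda>y. sinh (t * y) * cosh y - t * cosh (t * y) * sinh y)
        has_real_derivative D) (at y) \<and> 0 \<le> D"
      by blast
  qed
  then show ?thesis by simp
qed

lemma sinh_ratio_antimono:
  fixes t p q :: real
  assumes "0 < p" "p \<le> q" "0 \<le> t" "t \<le> 1"
  shows "sinh (t * q) / sinh q \<le> sinh (t * p) / sinh p"
proof (rule DERIV_nonpos_imp_nonincreasing[OF assms(2)])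
  fix y assume "p \<le> y"
  then have y: "0 < y" using assms by simp
  have "((\<lambda>y. sinh (t * y) / sinh y) has_real_derivative
      (t * cosh (t * y) * sinh y - sinh (t * y) * cosh y) / (sinh y)\<^sup>2) (at y)"
    using y by (auto intro!: derivative_eq_intros simp: power2_eq_square algebra_simps)
  moreover have "(t * cosh (t * y) * sinh y - sinh (t * y) * cosh y) / (sinh y)\<^sup>2 \<le> 0"
    using mult_cosh_mult_sinh_le[of y t] y assms by (intro divide_nonpos_nonneg) auto
  ultimately show "\<exists>D. ((\<lambda>y. sinh (t * y) / sinh y) has_real_derivative D) (at y) \<and> D \<le> 0"
    by blast
qed

lemma cosh_mult_abs: "cosh (\<bar>t\<bar> * x) = cosh (t * x)" for t x :: real
  by (cases "t \<ge> 0") auto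

text \<open>By the half-angle formula this is the square of \<open>sinh_mult_le\<close>. It serves
  to place a Euclidean ball inside the convex body.\<close>

lemma cosh_mult_diff_one_le:
  fixes t x :: real
  assumes "0 \<le> x" "\<bar>t\<bar> \<le> 1"
  shows "cosh (t * x) - 1 \<le> t\<^sup>2 * (cosh x - 1)"
proof -
  have "cosh (t * x) - 1 = 2 * (sinh (\<bar>t\<bar> * (x / 2)))\<^sup>2"
    using cosh_diff_one[of "\<bar>t\<bar> * x"] by (simp add: cosh_mult_abs)
  also have "\<dots> \<le> 2 * (\<bar>t\<bar> * sinh (x / 2))\<^sup>2"
    using assms by (intro mult_left_mono power_mono sinh_mult_le) auto
  also have "\<dots> = t\<^sup>2 * (cosh x - 1)"
    by (simp add: cosh_diff_one power_mult_distrib)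
  finally show ?thesis .
qed

lemma cosh_diff_one_ratio_antimono:
  fixes t p q :: real
  assumes "0 < p" "p \<le> q" "\<bar>t\<bar> \<le> 1"
  shows "(cosh (t * q) - 1) / (cosh q - 1) \<le> (cosh (t * p) - 1) / (cosh p - 1)"
proof -
  \<comment> \<open>The half-angle formula turns the quotient into a square. Evenness of
    \<open>cosh\<close> allows \<open>\<bar>t\<bar>\<close>, since the \<open>sinh\<close> lemma
    wants a nonnegative factor.\<close>
  have eq: "(cosh (t * x) - 1) / (cosh x - 1) = (sinh (\<bar>t\<bar> * (x / 2)) / sinh (x / 2))\<^sup>2" for x
    using cosh_diff_one[of "\<bar>t\<bar> * x"] cosh_diff_one[of x]
    by (simp add: cosh_mult_abs power_divide)
  show ?thesis
    unfolding eq using assms by (intro power_mono sinh_ratio_antimono) auto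
qed

lemma cosh_diff_one_ge: "x\<^sup>2 / 2 \<le> cosh x - 1" for x :: real
proof -
  have "(\<bar>x\<bar> / 2)\<^sup>2 \<le> (sinh (\<bar>x\<bar> / 2))\<^sup>2"
    by (intro power_mono sinh_ge_self) auto
  then show ?thesis
    using cosh_diff_one[of "\<bar>x\<bar>"] by (simp add: power_divide)
qed

lemma power2_norm_vec: "(norm x)\<^sup>2 = (\<Sum>i\<in>UNIV. (x $ i)\<^sup>2)" for x :: "real ^ 'n"
  unfolding power2_norm_eq_inner by (simp add: inner_vec_def power2_eq_square)

section \<open>Properties of the mass\<close>

lemma mass_eq_arcosh: "mass d a = arcosh (1 + real d * a\<^sup>2)"
  unfolding mass_def
  by (rule the1_equality[OF mass_ex1]) (simp add: cosh_arcosh_real)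

lemma cosh_mass: "cosh (mass d a) = 1 + real d * a\<^sup>2"
  using theI'[OF mass_ex1[of d a]] by (simp add: mass_def)

lemma mass_nonneg: "0 \<le> mass d a"
  using theI'[OF mass_ex1[of d a]] by (simp add: mass_def)

lemma mass_pos:
  assumes "0 < d" "0 < a"
  shows "0 < mass d a"
  using assms cosh_mass[of d a] mass_nonneg[of d a] by (cases "mass d a = 0") auto

lemma mass_mono:
  assumes "0 \<le> a" "a \<le> b"
  shows "mass d a \<le> mass d b"
proof -
  have "cosh (mass d a) \<le> cosh (mass d b)"
    using assms by (simp add: cosh_mass mult_left_mono)
  then show ?thesis by (simp add: cosh_real_nonneg_le_iff mass_nonneg)
qed

section \<open>The convex body and its rescaling\<close>

text \<open>Parametrised by \<open>m\<close> rather than \<open>a\<close> because bodies are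
  compared after rescaling by \<open>1 / m\<close>. Subtracting 1 makes every summand nonnegative
  and puts \<open>m\<close> times each coordinate vector on the boundary.\<close>

definition cosh_ball :: "real \<Rightarrow> (real ^ 'n) set" where
  "cosh_ball m = {l. (\<Sum>i\<in>UNIV. cosh (l $ i) - 1) \<le> cosh m - 1}"

lemma cosh_ball_component_le:
  assumes "l \<in> cosh_ball m" "0 \<le> m"
  shows "\<bar>l $ i\<bar> \<le> m"
proof -
  have "cosh (l $ i) - 1 \<le> (\<Sum>i\<in>UNIV. cosh (l $ i) - 1)"
    by (rule member_le_sum) (auto simp: cosh_real_ge_1)
  also have "\<dots> \<le> cosh m - 1"
    using assms by (simp add: cosh_ball_def)
  finally have "cosh \<bar>l $ i\<bar> \<le> cosh m" by simp
  then show ?thesis using assms by (simp only: cosh_real_nonneg_le_iff abs_ge_zero)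
qed

lemma uminus_cosh_ball: "- l \<in> cosh_ball m \<longleftrightarrow> l \<in> cosh_ball m"
  by (simp add: cosh_ball_def)

text \<open>Each \<open>t = l $ i / p\<close> has modulus at most 1, so
  \<open>cosh_diff_one_ratio_antimono\<close> applies coordinate by coordinate.\<close>

lemma scaled_cosh_ball_mono:
  fixes l :: "real ^ 'n"
  assumes "0 < p" "p \<le> q" "l \<in> cosh_ball p"
  shows "(q / p) *\<^sub>R l \<in> cosh_ball q"
proof -
  have pos: "0 < cosh p - 1" "0 < cosh q - 1"
    using assms cosh_real_strict_mono[of 0 p] cosh_real_strict_mono[of 0 q] by auto
  have "(\<Sum>i\<in>UNIV. cosh (((q / p) *\<^sub>R l) $ i) - 1) / (cosh q - 1)
      = (\<Sum>i\<in>UNIV. (cosh (l $ i / p * q) - 1) / (cosh q - 1))"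
    by (simp add: sum_divide_distrib mult.commute)
  also have "\<dots> \<le> (\<Sum>i\<in>UNIV. (cosh (l $ i / p * p) - 1) / (cosh p - 1))"
    using assms cosh_ball_component_le[OF assms(3)]
    by (intro sum_mono cosh_diff_one_ratio_antimono) auto
  also have "\<dots> = (\<Sum>i\<in>UNIV. cosh (l $ i) - 1) / (cosh p - 1)"
    using assms(1) by (simp add: sum_divide_distrib)
  also have "\<dots> \<le> 1"
    using assms pos by (simp add: cosh_ball_def)
  finally show ?thesis
    using pos by (simp add: cosh_ball_def)
qed

section \<open>Variational characterisation of \<open>a_norm\<close>\<close>

lemma
  fixes x :: "real ^ 'n"
  assumes "x \<noteq> 0" "0 < a"
  shows u_sol_pos: "0 < u_sol a x"
    and sum_sqrt_u_sol: "(\<Sum>i\<in>UNIV. sqrt (1 + (x $ i * u_sol a x)\<^sup>2)) = real CARD('n) * (1 + a\<^sup>2)"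
proof -
  have u: "0 \<le> u_sol a x"
    "(1 / real CARD('n)) * (\<Sum>i\<in>UNIV. sqrt (1 + (x $ i)\<^sup>2 * (u_sol a x)\<^sup>2)) = 1 + a\<^sup>2"
    using theI'[OF u_sol_ex1[OF assms(1), of a]] unfolding u_sol_def by blast+
  then show "(\<Sum>i\<in>UNIV. sqrt (1 + (x $ i * u_sol a x)\<^sup>2)) = real CARD('n) * (1 + a\<^sup>2)"
    by (simp add: field_simps power_mult_distrib)
  show "0 < u_sol a x"
    using u assms by (cases "u_sol a x = 0") auto
qed

lemma mem_cosh_ball_mass_iff:
  fixes l :: "real ^ 'n"
  shows "l \<in> cosh_ball (mass CARD('n) a) \<longleftrightarrow> (\<Sum>i\<in>UNIV. cosh (l $ i)) \<le> real CARD('n) * (1 + a\<^sup>2)"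
  by (simp add: cosh_ball_def cosh_mass sum_subtractf algebra_simps)

text \<open>Together the two facts say that \<open>mass * a_norm\<close> is the support function of
  the body. From here on \<open>a_norm\<close> is unfolded only at the zero vector.\<close>

lemma
  fixes x :: "real ^ 'n"
  assumes "0 < a"
  shows a_norm_attained: "\<exists>l\<in>cosh_ball (mass CARD('n) a). mass CARD('n) a * a_norm a x = x \<bullet> l"
    and inner_le_a_norm: "\<And>l. l \<in> cosh_ball (mass CARD('n) a) \<Longrightarrow> x \<bullet> l \<le> mass CARD('n) a * a_norm a x"
proof -
  let ?K = "cosh_ball (mass CARD('n) a) :: (real ^ 'n) set"
  have "\<exists>k\<in>?K. mass CARD('n) a * a_norm a x = x \<bullet> k \<and> (\<forall>l\<in>?K. x \<bullet> l \<le> x \<bullet> k)"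
  proof (cases "x = 0")
    case True
    have "0 \<in> ?K" by (simp add: cosh_ball_def cosh_real_ge_1)
    then show ?thesis using True by (auto simp: a_norm_def)
  next
    case False
    define u where "u = u_sol a x"
    \<comment> \<open>The Lagrange point: \<open>sinh (k $ i) = u * x $ i\<close> makes the gradient
      of the constraint parallel to \<open>x\<close>. The equation for \<open>u\<close> puts
      \<open>k\<close> on the boundary, as \<open>cosh (arsinh s) = sqrt (1 + s^2)\<close>.\<close>
    define k :: "real ^ 'n" where "k = (\<chi> i. arsinh (x $ i * u))"
    have u: "0 < u" "(\<Sum>i\<in>UNIV. sqrt (1 + (x $ i * u)\<^sup>2)) = real CARD('n) * (1 + a\<^sup>2)"
      using u_sol_pos[OF False assms] sum_sqrt_u_sol[OF False assms] by (auto simp: u_def)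
    have sum_k: "(\<Sum>i\<in>UNIV. cosh (k $ i)) = real CARD('n) * (1 + a\<^sup>2)"
      using u(2) by (simp add: k_def cosh_arsinh_real add.commute)
    have "x \<bullet> l \<le> x \<bullet> k" if "l \<in> ?K" for l
    proof -
      \<comment> \<open>Summing the tangent inequalities at \<open>k\<close> bounds
        \<open>u * (x \<bullet> (l - k))\<close> above by 0, and \<open>u\<close> is
        positive.\<close>
      have "real CARD('n) * (1 + a\<^sup>2) + u * (x \<bullet> (l - k))
          = (\<Sum>i\<in>UNIV. cosh (k $ i) + sinh (k $ i) * (l $ i - k $ i))"
        by (simp add: sum.distrib sum_k inner_vec_def sum_distrib_left)
           (simp add: k_def mult_ac)
      also have "\<dots> \<le> (\<Sum>i\<in>UNIV. cosh (l $ i))"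
        by (intro sum_mono cosh_above_tangent)
      also have "\<dots> \<le> real CARD('n) * (1 + a\<^sup>2)"
        using that by (simp add: mem_cosh_ball_mass_iff)
      finally show ?thesis
        using u(1) by (simp add: mult_le_0_iff inner_diff_right)
    qed
    moreover have "k \<in> ?K" by (simp add: mem_cosh_ball_mass_iff sum_k)
    moreover have "mass CARD('n) a * a_norm a x = x \<bullet> k"
      using False mass_pos[OF _ assms, of "CARD('n)"]
      by (simp add: a_norm_def inner_vec_def k_def u_def)
    ultimately show ?thesis by blast
  qed
  then show "\<exists>l\<in>?K. mass CARD('n) a * a_norm a x = x \<bullet> l"
    and "\<And>l. l \<in> ?K \<Longrightarrow> x \<bullet> l \<le> mass CARD('n) a * a_norm a x"
    by auto
qed

text \<open>An upper bound has to be checked on the whole body; in \<open>a_norm_geI\<close> a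
  single witness \<open>l\<close> gives a lower bound.\<close>

lemma a_norm_leI:
  fixes x :: "real ^ 'n"
  assumes "0 < a" "\<And>l. l \<in> cosh_ball (mass CARD('n) a) \<Longrightarrow> x \<bullet> l \<le> mass CARD('n) a * c"
  shows "a_norm a x \<le> c"
  using a_norm_attained[OF assms(1), of x] assms(2) mass_pos[OF _ assms(1), of "CARD('n)"]
  by (metis mult_le_cancel_left_pos zero_less_card_finite)

lemma a_norm_geI:
  fixes x l :: "real ^ 'n"
  assumes "0 < a" "l \<in> cosh_ball (mass CARD('n) a)" "mass CARD('n) a * c \<le> x \<bullet> l"
  shows "c \<le> a_norm a x"
  using order_trans[OF assms(3) inner_le_a_norm[OF assms(1,2)]] mass_pos[OF _ assms(1), of "CARD('n)"]
  by (simp add: mult_le_cancel_left_pos)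

section \<open>Comparison with the Euclidean and l1 norms\<close>

text \<open>The body contains the Euclidean sphere of radius \<open>m\<close>: the numbers
  \<open>x $ i / norm x\<close> have squares summing to 1. The witness is the point of this sphere
  in direction \<open>x\<close>.\<close>

lemma norm_le_a_norm:
  fixes x :: "real ^ 'n"
  assumes "0 < a"
  shows "norm x \<le> a_norm a x"
proof (cases "x = 0")
  case True
  then show ?thesis by (simp add: a_norm_def)
next
  case False
  let ?m = "mass CARD('n) a"
  have "(\<Sum>i\<in>UNIV. cosh (((?m / norm x) *\<^sub>R x) $ i) - 1)
      = (\<Sum>i\<in>UNIV. cosh (x $ i / norm x * ?m) - 1)"
    by (simp add: mult.commute)
  also have "\<dots> \<le> (\<Sum>i\<in>UNIV. (x $ i / norm x)\<^sup>2 * (cosh ?m - 1))"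
    using False by (intro sum_mono cosh_mult_diff_one_le mass_nonneg)
      (auto simp: component_le_norm_cart)
  also have "\<dots> = cosh ?m - 1"
    using False by (simp add: power_divide flip: sum_distrib_right sum_divide_distrib power2_norm_vec)
  finally show ?thesis
    using False
    by (intro a_norm_geI[OF assms, of "(?m / norm x) *\<^sub>R x"])
       (auto simp: cosh_ball_def power2_eq_square simp flip: power2_norm_eq_inner)
qed

text \<open>The body lies in the cube of half-side \<open>mass CARD('n) a\<close>.\<close>

lemma a_norm_le_l1_norm:
  fixes x :: "real ^ 'n"
  assumes "0 < a"
  shows "a_norm a x \<le> l1_norm x"
proof (rule a_norm_leI[OF assms])
  fix l :: "real ^ 'n" assume l: "l \<in> cosh_ball (mass CARD('n) a)"
  have "x $ i * l $ i \<le> mass CARD('n) a * \<bar>x $ i\<bar>" for i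
  proof -
    have "x $ i * l $ i \<le> \<bar>l $ i\<bar> * \<bar>x $ i\<bar>"
      by (metis abs_ge_self abs_mult mult.commute)
    also have "\<dots> \<le> mass CARD('n) a * \<bar>x $ i\<bar>"
      by (intro mult_right_mono cosh_ball_component_le[OF l] mass_nonneg) auto
    finally show ?thesis .
  qed
  then show "x \<bullet> l \<le> mass CARD('n) a * l1_norm x"
    by (auto simp: inner_vec_def l1_norm_def sum_distrib_left intro: sum_mono)
qed

text \<open>The body lies in the Euclidean ball of radius \<open>2 * sinh (m / 2)\<close>, which
  exceeds \<open>m\<close> by a factor of at most \<open>cosh m\<close>.\<close>

lemma a_norm_le_norm:
  fixes x :: "real ^ 'n"
  assumes "0 < a"
  shows "a_norm a x \<le> norm x * (1 + real CARD('n) * a\<^sup>2)"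
proof (rule a_norm_leI[OF assms])
  let ?m = "mass CARD('n) a"
  fix l :: "real ^ 'n" assume l: "l \<in> cosh_ball ?m"
  have "(norm l)\<^sup>2 / 2 = (\<Sum>i\<in>UNIV. (l $ i)\<^sup>2 / 2)"
    by (simp add: power2_norm_vec sum_divide_distrib)
  also have "\<dots> \<le> (\<Sum>i\<in>UNIV. cosh (l $ i) - 1)"
    by (intro sum_mono cosh_diff_one_ge)
  also have "\<dots> \<le> 2 * (sinh (?m / 2))\<^sup>2"
    using l cosh_diff_one[of ?m] by (simp add: cosh_ball_def)
  finally have "(norm l)\<^sup>2 \<le> (2 * sinh (?m / 2))\<^sup>2"
    by (simp add: power_mult_distrib)
  then have "norm l \<le> 2 * sinh (?m / 2)"
    by (rule power2_le_imp_le) (simp add: mass_nonneg)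
  also have "\<dots> \<le> ?m * cosh (?m / 2)"
    using sinh_le_mult_cosh[of "?m / 2"] mass_nonneg[of "CARD('n)" a] by simp
  \<comment> \<open>A crude step, taken because \<open>cosh ?m\<close> is exactly
    \<open>1 + d * a^2\<close>, the required form of error.\<close>
  also have "\<dots> \<le> ?m * cosh ?m"
    using mass_nonneg[of "CARD('n)" a] by (intro mult_left_mono) (auto simp: cosh_real_nonneg_le_iff)
  finally have "norm x * norm l \<le> norm x * (?m * (1 + real CARD('n) * a\<^sup>2))"
    by (intro mult_left_mono) (auto simp: cosh_mass)
  then show "x \<bullet> l \<le> ?m * (norm x * (1 + real CARD('n) * a\<^sup>2))"
    using norm_cauchy_schwarz[of x l] by (simp add: mult_ac)
qed

text \<open>The body contains the cube of half-side \<open>arcosh (1 + a^2)\<close>, obtained by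
  sharing the constraint equally among the coordinates. The witness takes its signs from
  \<open>x\<close>.\<close>

lemma l1_norm_le_a_norm:
  fixes x :: "real ^ 'n"
  assumes "0 < a"
  shows "arcosh (1 + a\<^sup>2) / arcosh (1 + real CARD('n) * a\<^sup>2) * l1_norm x \<le> a_norm a x"
proof (rule a_norm_geI[OF assms])
  let ?l = "(\<chi> i. sgn (x $ i) * arcosh (1 + a\<^sup>2)) :: real ^ 'n"
  \<comment> \<open>Only an inequality: where \<open>x $ i = 0\<close>, \<open>sgn\<close> gives the
    coordinate 0.\<close>
  have "cosh (?l $ i) \<le> 1 + a\<^sup>2" for i
    by (cases "x $ i" "0 :: real" rule: linorder_cases) (auto simp: cosh_arcosh_real)
  then have "(\<Sum>i\<in>UNIV. cosh (?l $ i)) \<le> real CARD('n) * (1 + a\<^sup>2)"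
    by (intro sum_bounded_above)
  then show "?l \<in> cosh_ball (mass CARD('n) a)"
    by (simp only: mem_cosh_ball_mass_iff)
  have "x \<bullet> ?l = arcosh (1 + a\<^sup>2) * l1_norm x"
    by (simp add: inner_vec_def l1_norm_def sum_distrib_left abs_sgn mult_ac)
  then show "mass CARD('n) a * (arcosh (1 + a\<^sup>2) / arcosh (1 + real CARD('n) * a\<^sup>2) * l1_norm x)
      \<le> x \<bullet> ?l"
    using mass_pos[OF _ assms, of "CARD('n)"] by (simp add: mass_eq_arcosh)
qed

section \<open>The norm axioms\<close>

text \<open>The body is symmetric, so the sign of \<open>c\<close> can be moved onto
  \<open>l\<close>.\<close>

lemma a_norm_scaleR:
  fixes x :: "real ^ 'n"
  assumes "0 < a"
  shows "a_norm a (c *\<^sub>R x) = \<bar>c\<bar> * a_norm a x"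
proof (rule antisym)
  let ?m = "mass CARD('n) a"
  have sign: "sgn c *\<^sub>R l \<in> cosh_ball ?m" if "l \<in> cosh_ball ?m" "c \<noteq> 0" for l :: "real ^ 'n"
    using that by (cases "c > 0") (auto simp: uminus_cosh_ball)
  have "(c *\<^sub>R x) \<bullet> l \<le> ?m * (\<bar>c\<bar> * a_norm a x)" if "l \<in> cosh_ball ?m" for l
  proof (cases "c = 0")
    case False
    have "(c *\<^sub>R x) \<bullet> l = \<bar>c\<bar> * (x \<bullet> (sgn c *\<^sub>R l))"
      by (simp flip: mult.assoc add: abs_mult_sgn)
    also have "\<dots> \<le> \<bar>c\<bar> * (?m * a_norm a x)"
      using False by (intro mult_left_mono inner_le_a_norm[OF assms] sign that) auto
    finally show ?thesis by (simp add: mult_ac)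
  qed simp
  then show "a_norm a (c *\<^sub>R x) \<le> \<bar>c\<bar> * a_norm a x"
    by (rule a_norm_leI[OF assms])
  show "\<bar>c\<bar> * a_norm a x \<le> a_norm a (c *\<^sub>R x)"
  proof (cases "c = 0")
    case False
    obtain l :: "real ^ 'n" where l: "l \<in> cosh_ball ?m" "?m * a_norm a x = x \<bullet> l"
      using a_norm_attained[OF assms] by blast
    have "?m * (\<bar>c\<bar> * a_norm a x) = \<bar>c\<bar> * (x \<bullet> l)"
      using l(2) by (simp add: mult_ac)
    also have "\<dots> = (c *\<^sub>R x) \<bullet> (sgn c *\<^sub>R l)"
      by (simp add: abs_sgn mult_ac)
    finally show ?thesis
      using False by (intro a_norm_geI[OF assms sign[OF l(1)]]) auto
  qed (simp add: a_norm_def)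
qed

text \<open>Support functions are subadditive: the same \<open>l\<close> is tested against
  \<open>x\<close> and against \<open>y\<close>.\<close>

lemma a_norm_triangle:
  fixes x y :: "real ^ 'n"
  assumes "0 < a"
  shows "a_norm a (x + y) \<le> a_norm a x + a_norm a y"
  using inner_le_a_norm[OF assms, of _ x] inner_le_a_norm[OF assms, of _ y]
  by (intro a_norm_leI[OF assms]) (simp add: inner_add_left ring_distribs add_mono)

lemma is_norm_a_norm:
  assumes "0 < a"
  shows "is_norm (a_norm a :: real ^ 'n \<Rightarrow> real)"
  unfolding is_norm_def
proof (intro conjI allI)
  fix x y :: "real ^ 'n" and c :: real
  show "0 \<le> a_norm a x"
    using norm_le_a_norm[OF assms, of x] norm_ge_zero[of x] by linarith
  show "a_norm a x = 0 \<longleftrightarrow> x = 0"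
    using norm_le_a_norm[OF assms, of x] by (auto simp: a_norm_def[of a 0])
  show "a_norm a (c *\<^sub>R x) = \<bar>c\<bar> * a_norm a x"
    by (rule a_norm_scaleR[OF assms])
  show "a_norm a (x + y) \<le> a_norm a x + a_norm a y"
    by (rule a_norm_triangle[OF assms])
qed

section \<open>Monotonicity and limits in \<open>a\<close>\<close>

text \<open>A maximiser for \<open>a\<close>, dilated by the ratio of the masses, is admissible for
  \<open>b\<close> and attains the same normalised value.\<close>

lemma mono_on_a_norm:
  fixes x :: "real ^ 'n"
  shows "mono_on {0<..} (\<lambda>a. a_norm a x)"
proof (rule mono_onI)
  fix a b :: real assume "a \<in> {0<..}" "b \<in> {0<..}" "a \<le> b"
  then have ab: "0 < a" "0 < b" "a \<le> b" by auto
  let ?p = "mass CARD('n) a" and ?q = "mass CARD('n) b"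
  have p: "0 < ?p" "?p \<le> ?q"
    using ab by (auto intro: mass_pos mass_mono)
  obtain l :: "real ^ 'n" where l: "l \<in> cosh_ball ?p" "?p * a_norm a x = x \<bullet> l"
    using a_norm_attained[OF ab(1)] by blast
  have "?q * a_norm a x = x \<bullet> ((?q / ?p) *\<^sub>R l)"
    using p(1) by (simp flip: l(2))
  then show "a_norm a x \<le> a_norm b x"
    by (intro a_norm_geI[OF ab(2) scaled_cosh_ball_mono[OF p l(1)]]) simp
qed

lemma a_norm_tendsto_norm:
  fixes x :: "real ^ 'n"
  shows "((\<lambda>a. a_norm a x) \<longlongrightarrow> norm x) (at_right 0)"
proof (rule tendsto_sandwich)
  show "\<forall>\<^sub>F a in at_right 0. norm x \<le> a_norm a x"
    using norm_le_a_norm[of _ x] by (auto simp: eventually_at_filter)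
  show "\<forall>\<^sub>F a in at_right 0. a_norm a x \<le> norm x * (1 + real CARD('n) * a\<^sup>2)"
    using a_norm_le_norm[of _ x] by (auto simp: eventually_at_filter)
  show "((\<lambda>a. norm x * (1 + real CARD('n) * a\<^sup>2)) \<longlongrightarrow> norm x) (at_right 0)"
    by (auto intro!: tendsto_eq_intros)
qed auto

text \<open>Both terms grow like \<open>2 * ln a\<close>; the constant \<open>c\<close> only
  contributes a bounded shift.\<close>

lemma arcosh_ratio_tendsto:
  fixes c :: real
  assumes "0 < c"
  shows "((\<lambda>a. arcosh (1 + a\<^sup>2) / arcosh (1 + c * a\<^sup>2)) \<longlongrightarrow> 1) at_top"
proof -
  have arcosh: "arcosh (1 + k * a\<^sup>2) = ln (1 + k * a\<^sup>2 + sqrt ((1 + k * a\<^sup>2)\<^sup>2 - 1))"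
    if "0 < k" for a k :: real
    using that by (simp add: arcosh_real_def)
  have "((\<lambda>a. ln (1 + 1 * a\<^sup>2 + sqrt ((1 + 1 * a\<^sup>2)\<^sup>2 - 1))
      / ln (1 + c * a\<^sup>2 + sqrt ((1 + c * a\<^sup>2)\<^sup>2 - 1))) \<longlongrightarrow> 1) at_top"
    using assms by real_asymp
  then show ?thesis
    using arcosh[of 1] arcosh[OF assms] by simp
qed

lemma a_norm_tendsto_l1_norm:
  fixes x :: "real ^ 'n"
  shows "((\<lambda>a. a_norm a x) \<longlongrightarrow> l1_norm x) at_top"
proof (rule tendsto_sandwich)
  let ?f = "\<lambda>a. arcosh (1 + a\<^sup>2) / arcosh (1 + real CARD('n) * a\<^sup>2) * l1_norm x"
  show "\<forall>\<^sub>F a in at_top. ?f a \<le> a_norm a x"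
    using eventually_gt_at_top[of 0] by eventually_elim (rule l1_norm_le_a_norm)
  show "\<forall>\<^sub>F a in at_top. a_norm a x \<le> l1_norm x"
    using eventually_gt_at_top[of 0] by eventually_elim (rule a_norm_le_l1_norm)
  show "(?f \<longlongrightarrow> l1_norm x) at_top"
    using tendsto_mult_right[OF arcosh_ratio_tendsto[of "real CARD('n)"], of "l1_norm x"] by simp
qed auto

lemma a_norm_eq_norm_uniform:
  "\<exists>(R :: real \<Rightarrow> real ^ 'n \<Rightarrow> real) C. \<forall>\<^sub>F a in at_right 0. \<forall>x. x \<noteq> 0 \<longrightarrow>
     a_norm a x = norm x * (1 + R a x) \<and> \<bar>R a x\<bar> \<le> C * a\<^sup>2"
proof (intro exI)
  \<comment> \<open>The relative error. It lies between 0 and \<open>d * a^2\<close> for every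
    \<open>a > 0\<close>, a bound free of \<open>x\<close>, which gives uniformity with
    \<open>C = d\<close>.\<close>
  let ?R = "\<lambda>a (x :: real ^ 'n). a_norm a x / norm x - 1"
  have "a_norm a x = norm x * (1 + ?R a x) \<and> \<bar>?R a x\<bar> \<le> real CARD('n) * a\<^sup>2"
    if "0 < a" "x \<noteq> 0" for a and x :: "real ^ 'n"
    using norm_le_a_norm[OF that(1), of x] a_norm_le_norm[OF that(1), of x] that
    by (simp add: abs_le_iff field_simps add_increasing)
  then show "\<forall>\<^sub>F a in at_right 0. \<forall>x. x \<noteq> 0 \<longrightarrow>
     a_norm a x = norm x * (1 + ?R a x) \<and> \<bar>?R a x\<bar> \<le> real CARD('n) * a\<^sup>2"
    by (auto simp: eventually_at_filter)
qed

theorem proposition1p2: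
  shows
    "(\<forall>a>0. is_norm (a_norm a :: real ^ 'n \<Rightarrow> real)) \<and>
     (\<forall>x :: real ^ 'n.
        mono_on {0<..} (\<lambda>a. a_norm a x) \<and>
        ((\<lambda>a. a_norm a x) \<longlongrightarrow> norm x) (at_right 0) \<and>
        ((\<lambda>a. a_norm a x) \<longlongrightarrow> l1_norm x) at_top) \<and>
     (\<exists>(R :: real \<Rightarrow> real ^ 'n \<Rightarrow> real) C.
        \<forall>\<^sub>F a in at_right 0. \<forall>x. x \<noteq> 0 \<longrightarrow>
          a_norm a x = norm x * (1 + R a x) \<and> \<bar>R a x\<bar> \<le> C * a\<^sup>2) \<and>
     (\<forall>a>0. \<forall>x :: real ^ 'n. norm x \<le> a_norm a x \<and> a_norm a x \<le> l1_norm x)"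
  by (intro conjI allI impI is_norm_a_norm mono_on_a_norm a_norm_tendsto_norm
      a_norm_tendsto_l1_norm a_norm_eq_norm_uniform norm_le_a_norm a_norm_le_l1_norm)

end
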